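(* Let $(T_1,T_2)$ be a pair of twisted contractions on a complex separable Hilbert space $\mathcal{H}$. For $i=1,2$ let $\mathcal{H}=\mathcal{H}_{ui}\oplus\mathcal{H}_{\neg ui}$ be the canonical decomposition for $T_i$ (with $T_i|_{\mathcal{H}_{ui}}$ unitary and $T_i|_{\mathcal{H}_{\neg ui}}$ completely non-unitary). If $T_i|_{\mathcal{H}_{\neg ui}}$ is in $C_{00}$ for $i=1,2$, then there is a unique decomposition \[ \mathcal{H}=\mathcal{H}_{uu}\oplus\mathcal{H}_{u\neg u}\oplus\mathcal{H}_{\neg uu}\oplus\mathcal{H}_{\neg u\neg u}, \] where $\mathcal{H}_{uu},\mathcal{H}_{u\neg u},\mathcal{H}_{\neg uu},\mathcal{H}_{\neg u\neg u}$ are subspaces of $\mathcal{H}$ reducing both $T_1$ and $T_2$ such that \begin{itemize} \item $T_1|_{\mathcal{H}_{uu}}$, $T_2|_{\mathcal{H}_{uu}}$ are unitary operators, \item $T_1|_{\mathcal{H}_{u\neg u}}$ is unitary and $T_2|_{\mathcal{H}_{u\neg u}}$ is completely non-unitary, \item $T_1|_{\mathcal{H}_{\neg uu}}$ is completely non-unitary and $T_2|_{\mathcal{H}_{\neg uu}}$ is unitary, \item $T_1|_{\mathcal{H}_{\neg u\neg u}}$, $T_2|_{\mathcal{H}_{\neg u\neg u}}$ are completely non-unitary operators. \end{itemize} Furthermore, the decomposition spaces are \begin{align*} \mathcal{H}_{uu}&=\bigcap_{m_2\in\mathbb{Z}_+}\left[\ker\big((I-T_2^{*m_2}T_2^{m_2})|_{\mathcal{H}_{u1}}\big)\cap\ker\big((I-T_2^{m_2}T_2^{*m_2})|_{\mathcal{H}_{u1}}\big)\right],\\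 \mathcal{H}_{u\neg u}&=\bigvee_{m_2\in\mathbb{Z}_+}\left\{(I-T_2^{*m_2}T_2^{m_2})\mathcal{H}_{u1}\cup(I-T_2^{m_2}T_2^{*m_2})\mathcal{H}_{u1}\right\},\\ \mathcal{H}_{\neg uu}&=\bigcap_{m_2\in\mathbb{Z}_+}\left[\ker\big((I-T_2^{*m_2}T_2^{m_2})|_{\mathcal{H}_{\neg u1}}\big)\cap\ker\big((I-T_2^{m_2}T_2^{*m_2})|_{\mathcal{H}_{\neg u1}}\big)\right],\\ \mathcal{H}_{\neg u\neg u}&=\bigvee_{m_2\in\mathbb{Z}_+}\left\{(I-T_2^{*m_2}T_2^{m_2})\mathcal{H}_{\neg u1}\cup(I-T_2^{m_2}T_2^{*m_2})\mathcal{H}_{\neg u1}\right\}, \end{align*} and \begin{align*} \mathcal{H}_{u1}&=\bigcap_{m_1\in\mathbb{Z}_+}\left[\ker(I-T_1^{*m_1}T_1^{m_1})\cap\ker(I-T_1^{m_1}T_1^{*m_1})\right],\\ \mathcal{H}_{\neg u1}&=\bigvee_{m_1\in\mathbb{Z}_+}\left\{(I-T_1^{*m_1}T_1^{m_1})\mathcal{H}\cup(I-T_1^{m_1}T_1^{*m_1})\mathcal{H}\right\}. \end{align*}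
   Context: Operators are bounded linear operators; $\mathbb{Z}_+$ is the set of nonnegative integers; $\bigvee$ denotes closed linear span. A pair $(T_1,T_2)$ of operators on $\mathcal{H}$ is called twisted if there is a unitary operator $U$ on $\mathcal{H}$ (a twist) such that $T_1T_2=UT_2T_1$ and $T_iU=UT_i$ for $i=1,2$. A closed subspace $\mathcal{M}$ reduces $T$ if $T\mathcal{M}\subseteq\mathcal{M}$ and $T\mathcal{M}^\perp\subseteq\mathcal{M}^\perp$. A contraction is completely non-unitary (c.n.u.) if it has no nonzero reducing subspace on which it is unitary. The canonical decomposition for a contraction $T$ on $\mathcal{H}$ is the unique orthogonal decomposition $\mathcal{H}=\mathcal{H}_u\oplus\mathcal{H}_{\neg u}$ into $T$-reducing subspaces (possibly $\{0\}$) such that $T|_{\mathcal{H}_u}$ is unitary and $T|_{\mathcal{H}_{\neg u}}$ is c.n.u. A contraction $T$ on $\mathcal{H}$ belongs to $C_{00}$ if $\lim_n\|T^nh\|=0=\lim_n\|T^{*n}h\|$ for all $h\in\mathcal{H}$. Any of the subspaces in a decomposition may be $\{0\}$. *)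

theory Defs
  imports "HOL-Analysis.Analysis"
begin

(* A complex inner product space is a real one (with inner product the real part of cinner),
   so that norm, metric and completeness come from HOL-Analysis.  cinner is linear in its
   first argument. *)

class complex_inner = real_inner +
  fixes scaleC :: "complex \<Rightarrow> 'a \<Rightarrow> 'a" (infixr "*\<^sub>C" 75)
    and cinner :: "'a \<Rightarrow> 'a \<Rightarrow> complex"
  assumes scaleC_add_right: "c *\<^sub>C (x + y) = c *\<^sub>C x + c *\<^sub>C y"
    and scaleC_add_left: "(c + d) *\<^sub>C x = c *\<^sub>C x + d *\<^sub>C x"
    and scaleC_scaleC: "c *\<^sub>C d *\<^sub>C x = (c * d) *\<^sub>C x"
    and scaleC_of_real: "complex_of_real r *\<^sub>C x = r *\<^sub>R x"
    and cinner_commute: "cinner x y = cnj (cinner y x)"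
    and cinner_add_left: "cinner (x + y) z = cinner x z + cinner y z"
    and cinner_scaleC_left: "cinner (c *\<^sub>C x) y = c * cinner x y"
    and Re_cinner: "Re (cinner x y) = inner x y"

class chilbert_space = complex_inner + complete_space

global_interpretation complex_vector: vector_space "scaleC :: complex \<Rightarrow> 'a \<Rightarrow> 'a::complex_inner"
  defines csubspace = complex_vector.subspace
    and cspan = complex_vector.span
proof
  fix x :: 'a
  show "1 *\<^sub>C x = x"
    using scaleC_of_real [of 1 x] by simp
qed (simp_all add: scaleC_add_right scaleC_add_left scaleC_scaleC)

definition closed_csubspace :: "'a::complex_inner set \<Rightarrow> bool" where
  "closed_csubspace M \<longleftrightarrow> csubspace M \<and> closed M"

definition closed_cspan :: "'a::complex_inner set \<Rightarrow> 'a set" where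
  "closed_cspan S = closure (cspan S)"

definition orthogonal_complement :: "'a::complex_inner set \<Rightarrow> 'a set" where
  "orthogonal_complement M = {x. \<forall>y\<in>M. cinner x y = 0}"

(* The Hilbert space is the orthogonal direct sum of the listed closed subspaces, any of
   which may be {0}. *)
definition orthogonal_decomposition :: "'a::complex_inner set list \<Rightarrow> bool" where
  "orthogonal_decomposition Ms \<longleftrightarrow>
     (\<forall>M\<in>set Ms. closed_csubspace M) \<and>
     sorted_wrt (\<lambda>M N. \<forall>x\<in>M. \<forall>y\<in>N. cinner x y = 0) Ms \<and>
     (\<forall>h. \<exists>hs. list_all2 (\<in>) hs Ms \<and> h = sum_list hs)"

(* The notions suffixed _on concern T|_K as an operator on the Hilbert space K, where K is a
   closed subspace that T maps into itself; operators on the whole space are the case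
   K = UNIV. *)

definition operator_on :: "'a::complex_inner set \<Rightarrow> ('a \<Rightarrow> 'a) \<Rightarrow> bool" where
  "operator_on K T \<longleftrightarrow>
     T ` K \<subseteq> K \<and>
     (\<forall>x\<in>K. \<forall>y\<in>K. T (x + y) = T x + T y) \<and>
     (\<forall>c. \<forall>x\<in>K. T (c *\<^sub>C x) = c *\<^sub>C T x) \<and>
     (\<exists>B. \<forall>x\<in>K. norm (T x) \<le> B * norm x)"

(* The adjoint of T|_K, extended by 0 outside K to make it unique as a total function. *)
definition adj_on :: "'a::complex_inner set \<Rightarrow> ('a \<Rightarrow> 'a) \<Rightarrow> 'a \<Rightarrow> 'a" where
  "adj_on K T = (THE S. (\<forall>x\<in>K. S x \<in> K) \<and> (\<forall>x. x \<notin> K \<longrightarrow> S x = 0) \<and>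
                        (\<forall>x\<in>K. \<forall>y\<in>K. cinner (T x) y = cinner x (S y)))"

abbreviation adj :: "('a::complex_inner \<Rightarrow> 'a) \<Rightarrow> 'a \<Rightarrow> 'a" where
  "adj \<equiv> adj_on UNIV"

definition contraction_on :: "'a::complex_inner set \<Rightarrow> ('a \<Rightarrow> 'a) \<Rightarrow> bool" where
  "contraction_on K T \<longleftrightarrow> operator_on K T \<and> (\<forall>x\<in>K. norm (T x) \<le> norm x)"

definition unitary_on :: "'a::complex_inner set \<Rightarrow> ('a \<Rightarrow> 'a) \<Rightarrow> bool" where
  "unitary_on K T \<longleftrightarrow>
     operator_on K T \<and> (\<forall>x\<in>K. adj_on K T (T x) = x \<and> T (adj_on K T x) = x)"

definition reduces_on :: "'a::complex_inner set \<Rightarrow> 'a set \<Rightarrow> ('a \<Rightarrow> 'a) \<Rightarrow> bool" where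
  "reduces_on K M T \<longleftrightarrow>
     closed_csubspace M \<and> M \<subseteq> K \<and> T ` M \<subseteq> M \<and>
     T ` (K \<inter> orthogonal_complement M) \<subseteq> K \<inter> orthogonal_complement M"

abbreviation reduces :: "'a::complex_inner set \<Rightarrow> ('a \<Rightarrow> 'a) \<Rightarrow> bool" where
  "reduces \<equiv> reduces_on UNIV"

definition cnu_on :: "'a::complex_inner set \<Rightarrow> ('a \<Rightarrow> 'a) \<Rightarrow> bool" where
  "cnu_on K T \<longleftrightarrow>
     contraction_on K T \<and> (\<forall>M. reduces_on K M T \<and> unitary_on M T \<longrightarrow> M = {0})"

definition C00_on :: "'a::complex_inner set \<Rightarrow> ('a \<Rightarrow> 'a) \<Rightarrow> bool" where
  "C00_on K T \<longleftrightarrow>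
     contraction_on K T \<and>
     (\<forall>h\<in>K. (\<lambda>n. norm ((T ^^ n) h)) \<longlonglongrightarrow> 0 \<and> (\<lambda>n. norm ((adj_on K T ^^ n) h)) \<longlonglongrightarrow> 0)"

definition canonical_decomposition ::
    "('a::complex_inner \<Rightarrow> 'a) \<Rightarrow> 'a set \<Rightarrow> 'a set \<Rightarrow> bool" where
  "canonical_decomposition T Hu Hn \<longleftrightarrow>
     orthogonal_decomposition [Hu, Hn] \<and> reduces Hu T \<and> reduces Hn T \<and>
     unitary_on Hu T \<and> cnu_on Hn T"

definition twisted :: "('a::complex_inner \<Rightarrow> 'a) \<Rightarrow> ('a \<Rightarrow> 'a) \<Rightarrow> bool" where
  "twisted T1 T2 \<longleftrightarrow>
     (\<exists>U. unitary_on UNIV U \<and> T1 \<circ> T2 = U \<circ> T2 \<circ> T1 \<and>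
          T1 \<circ> U = U \<circ> T1 \<and> T2 \<circ> U = U \<circ> T2)"

definition pair_decomposition ::
    "('a::complex_inner \<Rightarrow> 'a) \<Rightarrow> ('a \<Rightarrow> 'a) \<Rightarrow> 'a set \<Rightarrow> 'a set \<Rightarrow> 'a set \<Rightarrow> 'a set \<Rightarrow> bool" where
  "pair_decomposition T1 T2 Huu Hun Hnu Hnn \<longleftrightarrow>
     orthogonal_decomposition [Huu, Hun, Hnu, Hnn] \<and>
     (\<forall>M\<in>{Huu, Hun, Hnu, Hnn}. reduces M T1 \<and> reduces M T2) \<and>
     unitary_on Huu T1 \<and> unitary_on Huu T2 \<and>
     unitary_on Hun T1 \<and> cnu_on Hun T2 \<and>
     cnu_on Hnu T1 \<and> unitary_on Hnu T2 \<and>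
     cnu_on Hnn T1 \<and> cnu_on Hnn T2"

definition ker_on :: "'a::complex_inner set \<Rightarrow> ('a \<Rightarrow> 'a) \<Rightarrow> 'a set" where
  "ker_on K A = {x\<in>K. A x = 0}"

(* The operator I - A^m B^m. *)
definition defect :: "nat \<Rightarrow> ('a::complex_inner \<Rightarrow> 'a) \<Rightarrow> ('a \<Rightarrow> 'a) \<Rightarrow> 'a \<Rightarrow> 'a" where
  "defect m A B x = x - (A ^^ m) ((B ^^ m) x)"

end

theory Submission
  imports Defs
begin

text \<open>
  Let \<open>T\<close> be a contraction with canonical decomposition into \<open>Hu\<close> and \<open>Hn\<close> such that \<open>T\<close> is in C00
  on \<open>Hn\<close>. The powers of \<open>T\<close> and of its adjoint tend to 0 on \<open>Hn\<close>, whereas on \<open>Hu\<close> they are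
  isometric. Hence \<open>Hu\<close> is the common kernel of the defects \<open>I - T*^m T^m\<close> and \<open>I - T^m T*^m\<close>
  (\<open>mem_Hu_iff\<close>). The defects are self-adjoint and leave every subspace \<open>K\<close> reducing \<open>T\<close> invariant.
  This yields that \<open>K \<inter> Hn\<close> is the closed span of the ranges of the defects on \<open>K\<close>
  (\<open>defect_span_eq\<close>), that \<open>K\<close> is the sum of \<open>K \<inter> Hu\<close> and \<open>K \<inter> Hn\<close> (\<open>reducing_splits\<close>), and that
  \<open>T\<close> is unitary on \<open>K\<close> if and only if \<open>K \<subseteq> Hu\<close>, and completely non-unitary on \<open>K\<close> if and only if
  \<open>K \<subseteq> Hn\<close>.

  The twist enters at one place, \<open>twisted_reduces\<close>: for a twisted pair, the two parts of one
  operator reduce the other operator. If \<open>x \<in> Hu\<close> and \<open>y \<in> Hn\<close>, then \<open>x\<close> can be written as the image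
  under the \<open>m\<close>-th power of \<open>T\<close> of a vector of the same norm. Moving that power across the second
  operator costs only a power of the unitary twist, and on \<open>y\<close> it becomes a power of the adjoint,
  which tends to 0. So the second operator maps \<open>Hu\<close> to the orthogonal complement of \<open>Hn\<close>, and by a
  similar argument \<open>Hn\<close> to that of \<open>Hu\<close>.

  The four spaces are then forced to be the intersections of a part of \<open>T1\<close> with a part of \<open>T2\<close>
  (\<open>pair_decomposition_iff\<close>): these intersections do form a decomposition of the required kind, the
  pieces of any other one are contained in them by the two inclusion criteria, and two orthogonal
  decompositions with such inclusions coincide (\<open>orthogonal_decomposition_eqI\<close>). The formulas for the
  spaces are the kernel and span descriptions of \<open>K \<inter> Hu2\<close> and \<open>K \<inter> Hn2\<close> for \<open>K = Hu1\<close> and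
  \<open>K = Hn1\<close>, and those of \<open>Hu1\<close> and \<open>Hn1\<close> for \<open>K\<close> the whole space.

  Adjoints and projections both come from the Riesz representation theorem on a closed subspace.
\<close>

section \<open>Complex inner products\<close>

lemma cinner_add_right: "cinner x (y + z) = cinner x y + cinner x z"
  for x y z :: "'a::complex_inner"
  by (metis cinner_add_left cinner_commute complex_cnj_add)

lemma cinner_scaleC_right: "cinner x (c *\<^sub>C y) = cnj c * cinner x y"
  for x y :: "'a::complex_inner"
  by (metis cinner_scaleC_left cinner_commute complex_cnj_mult)

lemma cinner_zero_left [simp]: "cinner 0 y = 0" for y :: "'a::complex_inner"
  using cinner_add_left [of 0 0 y] by simp

lemma cinner_zero_right [simp]: "cinner y 0 = 0" for y :: "'a::complex_inner"
  using cinner_add_right [of y 0 0] by simp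

lemma cinner_diff_left: "cinner (x - y) z = cinner x z - cinner y z"
  for x y z :: "'a::complex_inner"
  using cinner_add_left [of "x - y" y z] by simp

lemma cinner_diff_right: "cinner x (y - z) = cinner x y - cinner x z"
  for x y z :: "'a::complex_inner"
  using cinner_add_right [of x "y - z" z] by simp

lemma cinner_eq_0_commute: "cinner x y = 0 \<longleftrightarrow> cinner y x = 0" for x y :: "'a::complex_inner"
  by (metis cinner_commute complex_cnj_zero)

lemma cinner_self: "cinner x x = complex_of_real ((norm x)\<^sup>2)" for x :: "'a::complex_inner"
proof -
  have "Im (cinner x x) = 0"
    using arg_cong [OF cinner_commute [of x x], of Im] by simp
  then show ?thesis
    by (simp add: complex_eq_iff Re_cinner power2_norm_eq_inner)
qed

lemma cinner_self_eq_0 [simp]: "cinner x x = 0 \<longleftrightarrow> x = 0" for x :: "'a::complex_inner"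
  by (simp add: cinner_self)

lemma cinner_extensionality:
  fixes x y :: "'a::complex_inner"
  assumes "\<And>z. cinner z x = cinner z y"
  shows "x = y"
  using assms [of "x - y"] by (metis cinner_diff_right cinner_self_eq_0 right_minus_eq)

lemma norm_scaleC: "norm (c *\<^sub>C x) = cmod c * norm x" for x :: "'a::complex_inner"
proof -
  have "complex_of_real ((norm (c *\<^sub>C x))\<^sup>2) = (c * cnj c) * cinner x x"
    by (simp only: cinner_self [symmetric] cinner_scaleC_left cinner_scaleC_right mult_ac)
  also have "\<dots> = complex_of_real ((cmod c * norm x)\<^sup>2)"
    by (simp add: complex_norm_square [symmetric] cinner_self power_mult_distrib)
  finally have "(norm (c *\<^sub>C x))\<^sup>2 = (cmod c * norm x)\<^sup>2"
    using of_real_eq_iff by blast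
  then show ?thesis
    by (simp add: power2_eq_iff_nonneg)
qed

text \<open>The complex bound follows from the real one after rotating \<open>x\<close> by the conjugate of
  \<open>cinner x y\<close>, which makes the product real and nonnegative.\<close>

lemma cinner_Cauchy_Schwarz: "cmod (cinner x y) \<le> norm x * norm y" for x y :: "'a::complex_inner"
proof -
  let ?w = "cinner x y"
  have "complex_of_real ((cmod ?w)\<^sup>2) = cinner (cnj ?w *\<^sub>C x) y"
    by (simp only: complex_norm_square cinner_scaleC_left mult.commute)
  then have "(cmod ?w)\<^sup>2 = inner (cnj ?w *\<^sub>C x) y"
    by (metis Re_cinner Re_complex_of_real)
  also have "\<dots> \<le> norm (cnj ?w *\<^sub>C x) * norm y"
    by (rule norm_cauchy_schwarz)
  finally have "cmod ?w * cmod ?w \<le> cmod ?w * (norm x * norm y)"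
    by (simp add: norm_scaleC power2_eq_square mult.assoc)
  then show ?thesis
    by (cases "cmod ?w = 0") auto
qed

lemma tendsto_cinner_right:
  fixes x :: "'a::complex_inner"
  assumes "X \<longlonglongrightarrow> y"
  shows "(\<lambda>n. cinner x (X n)) \<longlonglongrightarrow> cinner x y"
proof -
  have "(\<lambda>n. norm x * norm (X n - y)) \<longlonglongrightarrow> norm x * 0"
    using assms by (intro tendsto_intros) (simp add: LIM_zero tendsto_norm_zero)
  then have "(\<lambda>n. cinner x (X n) - cinner x y) \<longlonglongrightarrow> 0"
    by (intro Lim_null_comparison [of "\<lambda>n. cinner x (X n) - cinner x y"])
       (auto simp: cinner_diff_right [symmetric] cinner_Cauchy_Schwarz)
  then show ?thesis
    by (rule LIM_zero_cancel)
qed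

lemma closed_cinner_zero: "closed {x. cinner y x = 0}" for y :: "'a::complex_inner"
  unfolding closed_sequential_limits
proof (intro allI impI, elim conjE)
  fix X l assume "\<forall>n. X n \<in> {x. cinner y x = 0}" and "X \<longlonglongrightarrow> l"
  then show "l \<in> {x. cinner y x = 0}"
    using tendsto_cinner_right [of X l y] by (simp add: LIMSEQ_const_iff)
qed

section \<open>Closed subspaces\<close>

lemma closed_csubspaceD:
  assumes "closed_csubspace M"
  shows "0 \<in> M" "x \<in> M \<Longrightarrow> y \<in> M \<Longrightarrow> x + y \<in> M" "x \<in> M \<Longrightarrow> y \<in> M \<Longrightarrow> x - y \<in> M"
    "x \<in> M \<Longrightarrow> c *\<^sub>C x \<in> M" "x \<in> M \<Longrightarrow> r *\<^sub>R x \<in> M"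
  using assms unfolding closed_csubspace_def scaleC_of_real [symmetric]
  by (simp_all add: complex_vector.subspace_0 complex_vector.subspace_add
      complex_vector.subspace_diff complex_vector.subspace_scale)

lemma closed_csubspace_UNIV: "closed_csubspace UNIV"
  by (simp add: closed_csubspace_def complex_vector.subspace_UNIV)

lemma closed_csubspace_Int:
  "closed_csubspace M \<Longrightarrow> closed_csubspace N \<Longrightarrow> closed_csubspace (M \<inter> N)"
  by (simp add: closed_csubspace_def complex_vector.subspace_inter closed_Int)

lemma closed_csubspace_orthogonal_complement: "closed_csubspace (orthogonal_complement M)"
proof -
  have eq: "orthogonal_complement M = (\<Inter>y\<in>M. {x. cinner y x = 0})"
    by (auto simp: orthogonal_complement_def cinner_eq_0_commute)
  have "closed (orthogonal_complement M)"
    unfolding eq by (intro closed_INT ballI closed_cinner_zero)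
  then show ?thesis
    by (auto simp: closed_csubspace_def complex_vector.subspace_def orthogonal_complement_def
        cinner_add_left cinner_scaleC_left)
qed

lemma closed_cspan_superset: "S \<subseteq> closed_cspan S"
  using complex_vector.span_superset closure_subset unfolding closed_cspan_def by blast

lemma closed_cspan_minimal:
  "S \<subseteq> M \<Longrightarrow> closed_csubspace M \<Longrightarrow> closed_cspan S \<subseteq> M"
  by (simp add: closed_cspan_def closed_csubspace_def closure_minimal complex_vector.span_minimal)

lemma tendsto_scaleC:
  fixes X :: "nat \<Rightarrow> 'a::complex_inner"
  assumes "X \<longlonglongrightarrow> x"
  shows "(\<lambda>n. c *\<^sub>C X n) \<longlonglongrightarrow> c *\<^sub>C x"
proof -
  have "(\<lambda>n. cmod c * norm (X n - x)) \<longlonglongrightarrow> cmod c * 0"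
    using assms by (intro tendsto_intros) (simp add: LIM_zero tendsto_norm_zero)
  then show ?thesis
    by (simp add: tendsto_iff dist_norm norm_scaleC complex_vector.scale_right_diff_distrib [symmetric])
qed

lemma closed_csubspace_closed_cspan: "closed_csubspace (closed_cspan S)"
  unfolding closed_csubspace_def complex_vector.subspace_def
proof (intro conjI ballI allI)
  show "0 \<in> closed_cspan S"
    using closure_subset complex_vector.span_zero unfolding closed_cspan_def by (rule subsetD)
next
  fix x y assume "x \<in> closed_cspan S" "y \<in> closed_cspan S"
  then obtain X Y where "\<And>n. X n \<in> cspan S" "X \<longlonglongrightarrow> x" "\<And>n. Y n \<in> cspan S" "Y \<longlonglongrightarrow> y"
    by (auto simp: closed_cspan_def closure_sequential)
  then show "x + y \<in> closed_cspan S"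
    unfolding closed_cspan_def closure_sequential
    by (intro exI [of _ "\<lambda>n. X n + Y n"]) (simp add: complex_vector.span_add tendsto_add)
next
  fix c x assume "x \<in> closed_cspan S"
  then obtain X where "\<And>n. X n \<in> cspan S" "X \<longlonglongrightarrow> x"
    by (auto simp: closed_cspan_def closure_sequential)
  then show "c *\<^sub>C x \<in> closed_cspan S"
    unfolding closed_cspan_def closure_sequential
    by (intro exI [of _ "\<lambda>n. c *\<^sub>C X n"]) (simp add: complex_vector.span_scale tendsto_scaleC)
qed (simp add: closed_cspan_def)

section \<open>Riesz representation, projections and adjoints\<close>

text \<open>Near 0 the linear term dominates the quadratic one; \<open>t = - c / (q + 1)\<close> is close enough to 0
  for any \<open>q\<close>, even \<open>q = 0\<close>.\<close>

lemma linear_term_zero: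
  fixes q c :: real
  assumes "0 \<le> q" and nonneg: "\<And>t. 0 \<le> t\<^sup>2 * q + 2 * t * c"
  shows "c = 0"
proof -
  define s t where "s = q + 1" and "t = - c / s"
  then have s: "0 < s" and ts: "t * s = - c"
    using \<open>0 \<le> q\<close> by simp_all
  have "0 \<le> s\<^sup>2 * (t\<^sup>2 * q + 2 * t * c)"
    using nonneg [of t] by simp
  also have "\<dots> = (t * s)\<^sup>2 * q + 2 * (t * s) * c * s"
    by (simp add: power2_eq_square algebra_simps)
  also have "\<dots> = - (c\<^sup>2 * (q + 2))"
    unfolding ts by (simp add: s_def power2_eq_square algebra_simps)
  finally have "c\<^sup>2 * (q + 2) \<le> 0"
    by simp
  then show ?thesis
    using \<open>0 \<le> q\<close> by (simp add: mult_le_0_iff)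
qed

text \<open>The representing vector minimises \<open>J y = \<parallel>y\<parallel>\<^sup>2 - 2 g y\<close>: the parallelogram law makes minimising
  sequences Cauchy, and the vanishing of the first variation of \<open>J\<close> at the minimum is the
  representation formula.\<close>

lemma Riesz_real:
  fixes K :: "'a::chilbert_space set" and g :: "'a \<Rightarrow> real"
  assumes K: "closed_csubspace K"
    and add: "\<And>x y. x \<in> K \<Longrightarrow> y \<in> K \<Longrightarrow> g (x + y) = g x + g y"
    and scale: "\<And>r x. x \<in> K \<Longrightarrow> g (r *\<^sub>R x) = r * g x"
    and bound: "\<And>x. x \<in> K \<Longrightarrow> \<bar>g x\<bar> \<le> B * norm x"
  shows "\<exists>y\<in>K. \<forall>x\<in>K. g x = inner x y"
proof -
  note [intro] = closed_csubspaceD [OF K]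
  have gdiff: "g (x - y) = g x - g y" if "x \<in> K" "y \<in> K" for x y
    using add [of "x - y" y] that closed_csubspaceD(3) [OF K] by simp
  define J where "J y = (norm y)\<^sup>2 - 2 * g y" for y
  have J_lower: "- B\<^sup>2 \<le> J y" if "y \<in> K" for y
  proof -
    have "0 \<le> (norm y - B)\<^sup>2"
      by simp
    then show ?thesis
      using bound [OF that] by (simp add: J_def power2_eq_square algebra_simps)
  qed
  define d where "d = Inf (J ` K)"
  have bdd: "bdd_below (J ` K)"
    using J_lower by (auto intro!: bdd_belowI [of _ "- B\<^sup>2"])
  have d_le: "d \<le> J y" if "y \<in> K" for y
    unfolding d_def using bdd that by (auto intro: cInf_lower)
  have "\<exists>y\<in>K. J y < d + 1 / Suc n" for n
    using cInf_lessD [of "J ` K" "d + 1 / Suc n"] closed_csubspaceD(1) [OF K]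
    by (auto simp: d_def)
  then obtain Y where YK: "\<And>n. Y n \<in> K" and YJ: "\<And>n. J (Y n) < d + 1 / Suc n"
    by metis
  have parallelogram: "(norm (y - z))\<^sup>2 \<le> 2 * (J y + J z - 2 * d)" if "y \<in> K" "z \<in> K" for y z
  proof -
    have "J ((1/2) *\<^sub>R (y + z)) = (J y + J z) / 2 - (norm (y - z))\<^sup>2 / 4"
      unfolding J_def power2_norm_eq_inner scale [OF closed_csubspaceD(2) [OF K that]] add [OF that]
      by (simp add: inner_add_left inner_add_right inner_diff_left inner_diff_right
          inner_commute [of z y] field_simps)
    moreover have "d \<le> J ((1/2) *\<^sub>R (y + z))"
      using that by (auto intro: d_le)
    ultimately show ?thesis
      by argo
  qed
  have "Cauchy Y"
  proof (rule metric_CauchyI)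
    fix e :: real assume "0 < e"
    then have "0 < e\<^sup>2 / 4"
      by simp
    then obtain N where N: "1 / Suc N < e\<^sup>2 / 4"
      using nat_approx_posE by blast
    show "\<exists>M. \<forall>m\<ge>M. \<forall>n\<ge>M. dist (Y m) (Y n) < e"
    proof (intro exI allI impI)
      fix m n assume "m \<ge> N" "n \<ge> N"
      then have "1 / Suc m \<le> 1 / Suc N" "1 / Suc n \<le> 1 / Suc N"
        by (simp_all add: frac_le)
      then have "(norm (Y m - Y n))\<^sup>2 < e\<^sup>2"
        using parallelogram [OF YK YK, of m n] YJ [of m] YJ [of n] N by argo
      then show "dist (Y m) (Y n) < e"
        using \<open>0 < e\<close> by (simp add: dist_norm power2_less_imp_less)
    qed
  qed
  then obtain y where lim: "Y \<longlonglongrightarrow> y"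
    using Cauchy_convergent convergent_def by blast
  have yK: "y \<in> K"
    using K YK lim by (auto simp: closed_csubspace_def intro: closed_sequentially)
  have "(\<lambda>n. g (Y n) - g y) \<longlonglongrightarrow> 0"
  proof (rule Lim_null_comparison)
    show "\<forall>\<^sub>F n in sequentially. norm (g (Y n) - g y) \<le> B * norm (Y n - y)"
      using bound YK yK by (auto simp: gdiff [symmetric] closed_csubspaceD(3) [OF K])
    have "(\<lambda>n. B * norm (Y n - y)) \<longlonglongrightarrow> B * 0"
      using lim by (intro tendsto_intros) (simp add: LIM_zero tendsto_norm_zero)
    then show "(\<lambda>n. B * norm (Y n - y)) \<longlonglongrightarrow> 0"
      by simp
  qed
  then have "(\<lambda>n. J (Y n)) \<longlonglongrightarrow> J y"
    unfolding J_def using lim by (intro tendsto_intros) (auto intro: LIM_zero_cancel)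
  moreover have "(\<lambda>n. d + 1 / Suc n) \<longlonglongrightarrow> d + 0"
    using LIMSEQ_inverse_real_of_nat by (intro tendsto_intros) (simp add: inverse_eq_divide)
  ultimately have J_y: "J y \<le> d"
    using YJ by (intro LIMSEQ_le [of "\<lambda>n. J (Y n)" _ "\<lambda>n. d + 1 / Suc n"]) (auto intro: less_imp_le)
  have "g x = inner x y" if x: "x \<in> K" for x
  proof -
    let ?c = "inner x y - g x" and ?q = "(norm x)\<^sup>2"
    have var: "0 \<le> t\<^sup>2 * ?q + 2 * t * ?c" for t
    proof -
      have "J (y + t *\<^sub>R x) = J y + t\<^sup>2 * ?q + 2 * t * ?c"
        using x yK add [OF yK closed_csubspaceD(5) [OF K x, of t]]
        unfolding J_def power2_norm_eq_inner
        by (simp add: scale inner_add_left inner_add_right inner_commute [of x y]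
            power2_eq_square algebra_simps)
      moreover have "d \<le> J (y + t *\<^sub>R x)"
        using x yK by (auto intro!: d_le)
      ultimately show ?thesis
        using J_y by linarith
    qed
    show ?thesis
      using linear_term_zero [OF _ var] by simp
  qed
  with yK show ?thesis
    by blast
qed

lemma Riesz_representation:
  fixes K :: "'a::chilbert_space set" and f :: "'a \<Rightarrow> complex"
  assumes K: "closed_csubspace K"
    and add: "\<And>x y. x \<in> K \<Longrightarrow> y \<in> K \<Longrightarrow> f (x + y) = f x + f y"
    and scale: "\<And>c x. x \<in> K \<Longrightarrow> f (c *\<^sub>C x) = c * f x"
    and bound: "\<And>x. x \<in> K \<Longrightarrow> cmod (f x) \<le> B * norm x"
  shows "\<exists>y\<in>K. \<forall>x\<in>K. f x = cinner x y"
proof -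
  have "\<exists>y\<in>K. \<forall>x\<in>K. Re (f x) = inner x y"
  proof (rule Riesz_real [OF K])
    show "Re (f (x + y)) = Re (f x) + Re (f y)" if "x \<in> K" "y \<in> K" for x y
      using add that by simp
    show "Re (f (r *\<^sub>R x)) = r * Re (f x)" if "x \<in> K" for r x
      using scale [OF that, of "complex_of_real r"] by (simp add: scaleC_of_real)
    show "\<bar>Re (f x)\<bar> \<le> B * norm x" if "x \<in> K" for x
      using bound [OF that] abs_Re_le_cmod order_trans by blast
  qed
  then obtain y where yK: "y \<in> K" and y: "\<And>x. x \<in> K \<Longrightarrow> Re (f x) = Re (cinner x y)"
    by (auto simp: Re_cinner)
  have "f x = cinner x y" if "x \<in> K" for x
  proof (rule complex_eqI)
    (* the imaginary part is the real part at - i x *)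
    show "Im (f x) = Im (cinner x y)"
      using y [of "(- \<i>) *\<^sub>C x"] scale [of x "- \<i>"] that closed_csubspaceD(4) [OF K, of x "- \<i>"]
      by (simp add: cinner_scaleC_left del: complex_vector.scale_minus_left)
  qed (use y that in simp)
  with yK show ?thesis
    by blast
qed

text \<open>The projection of \<open>x\<close> represents the functional \<open>\<lambda>z. cinner z x\<close> on \<open>M\<close>.\<close>

lemma orthogonal_projection:
  fixes M :: "'a::chilbert_space set"
  assumes "closed_csubspace M"
  obtains p q where "p \<in> M" "q \<in> orthogonal_complement M" "x = p + q"
proof -
  have "\<exists>y\<in>M. \<forall>z\<in>M. cinner z x = cinner z y"
    using assms by (rule Riesz_representation [where B = "norm x"])
      (auto simp: cinner_add_left cinner_scaleC_left cinner_Cauchy_Schwarz mult.commute)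
  then obtain p where "p \<in> M" "\<forall>z\<in>M. cinner z (x - p) = 0"
    by (auto simp: cinner_diff_right)
  then show thesis
    by (intro that [of p "x - p"]) (auto simp: orthogonal_complement_def cinner_eq_0_commute)
qed

lemma orthogonal_complement_orthogonal_complement:
  fixes M :: "'a::chilbert_space set"
  assumes M: "closed_csubspace M"
  shows "orthogonal_complement (orthogonal_complement M) = M"
proof
  show "M \<subseteq> orthogonal_complement (orthogonal_complement M)"
    by (auto simp: orthogonal_complement_def cinner_eq_0_commute)
  show "orthogonal_complement (orthogonal_complement M) \<subseteq> M"
  proof
    fix x assume x: "x \<in> orthogonal_complement (orthogonal_complement M)"
    obtain p q where pq: "p \<in> M" "q \<in> orthogonal_complement M" "x = p + q"
      using orthogonal_projection [OF M] .
    then have "cinner q q = cinner x q - cinner p q"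
      by (simp add: cinner_add_left)
    also have "\<dots> = 0"
      using x pq cinner_eq_0_commute by (auto simp: orthogonal_complement_def)
    finally show "x \<in> M"
      using pq by simp
  qed
qed

text \<open>The candidate is cut off outside \<open>K\<close>, since \<open>adj_on\<close> describes a total function that is 0
  there.\<close>

lemma adj_on_eqI:
  fixes K :: "'a::chilbert_space set"
  assumes K: "closed_csubspace K" and "\<And>x. x \<in> K \<Longrightarrow> S x \<in> K"
    and "\<And>x y. x \<in> K \<Longrightarrow> y \<in> K \<Longrightarrow> cinner (T x) y = cinner x (S y)"
    and "x \<in> K"
  shows "adj_on K T x = S x"
proof -
  define S' where "S' x = (if x \<in> K then S x else 0)" for x
  have "adj_on K T = S'"
    unfolding adj_on_def
  proof (rule the_equality)
    show "(\<forall>x\<in>K. S' x \<in> K) \<and> (\<forall>x. x \<notin> K \<longrightarrow> S' x = 0) \<and>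
      (\<forall>x\<in>K. \<forall>y\<in>K. cinner (T x) y = cinner x (S' y))"
      using assms by (simp add: S'_def)
  next
    fix R assume R: "(\<forall>x\<in>K. R x \<in> K) \<and> (\<forall>x. x \<notin> K \<longrightarrow> R x = 0) \<and>
      (\<forall>x\<in>K. \<forall>y\<in>K. cinner (T x) y = cinner x (R y))"
    show "R = S'"
    proof
      fix y
      show "R y = S' y"
      proof (cases "y \<in> K")
        case True
        then have "R y - S y \<in> K"
          using R assms closed_csubspaceD(3) [OF K] by blast
        then have "cinner (R y - S y) (R y - S y) = 0"
          using R assms True by (metis cinner_diff_right right_minus_eq)
        then show ?thesis
          using True by (simp add: S'_def)
      qed (use R in \<open>simp add: S'_def\<close>)
    qed
  qed
  with \<open>x \<in> K\<close> show ?thesis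
    by (simp add: S'_def)
qed

lemma adj_on:
  fixes K :: "'a::chilbert_space set"
  assumes K: "closed_csubspace K" and T: "operator_on K T"
  shows "y \<in> K \<Longrightarrow> adj_on K T y \<in> K"
    and "x \<in> K \<Longrightarrow> y \<in> K \<Longrightarrow> cinner (T x) y = cinner x (adj_on K T y)"
proof -
  obtain B where B: "\<And>x. x \<in> K \<Longrightarrow> norm (T x) \<le> B * norm x"
    using T unfolding operator_on_def by meson
  have add: "T (x + y) = T x + T y" and scale: "T (c *\<^sub>C x) = c *\<^sub>C T x"
    if "x \<in> K" "y \<in> K" for x y c
    using T that unfolding operator_on_def by blast+
  have "\<exists>z\<in>K. \<forall>x\<in>K. cinner (T x) y = cinner x z" for y
  proof (rule Riesz_representation [OF K])
    show "cmod (cinner (T x) y) \<le> (B * norm y) * norm x" if "x \<in> K" for x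
      using order_trans [OF cinner_Cauchy_Schwarz mult_right_mono [OF B [OF that] norm_ge_zero [of y]]]
      by (simp add: mult_ac)
  qed (simp_all add: add scale cinner_add_left cinner_scaleC_left)
  then obtain S where S: "\<And>y. S y \<in> K" "\<And>x y. x \<in> K \<Longrightarrow> cinner (T x) y = cinner x (S y)"
    by metis
  have "adj_on K T y = S y" if "y \<in> K" for y
    by (rule adj_on_eqI [OF K _ _ that]) (rule S; assumption)+
  with S show "y \<in> K \<Longrightarrow> adj_on K T y \<in> K"
    and "x \<in> K \<Longrightarrow> y \<in> K \<Longrightarrow> cinner (T x) y = cinner x (adj_on K T y)"
    by simp_all
qed

text \<open>Linearity of both operators is a consequence of this relation, so everything about an
  operator and its adjoint that does not need boundedness is derived from it.\<close>

definition adjoint_pair :: "('a::complex_inner \<Rightarrow> 'a) \<Rightarrow> ('a \<Rightarrow> 'a) \<Rightarrow> bool" where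
  "adjoint_pair A B \<longleftrightarrow> (\<forall>x y. cinner (A x) y = cinner x (B y))"

lemma adjoint_pairD: "adjoint_pair A B \<Longrightarrow> cinner (A x) y = cinner x (B y)"
  by (simp add: adjoint_pair_def)

lemma adjoint_pair_sym: "adjoint_pair A B \<Longrightarrow> adjoint_pair B A"
  unfolding adjoint_pair_def by (metis cinner_commute)

lemma adjoint_pair_diff:
  assumes "adjoint_pair A B"
  shows "A (x - y) = A x - A y"
  by (rule cinner_extensionality)
    (simp add: adjoint_pairD [OF adjoint_pair_sym [OF assms], symmetric] cinner_diff_right)

lemma adjoint_pair_scaleC:
  assumes "adjoint_pair A B"
  shows "A (c *\<^sub>C x) = c *\<^sub>C A x"
  by (rule cinner_extensionality)
    (simp add: adjoint_pairD [OF adjoint_pair_sym [OF assms], symmetric] cinner_scaleC_right)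

lemma adjoint_pair_add:
  assumes "adjoint_pair A B"
  shows "A (x + y) = A x + A y"
  by (rule cinner_extensionality)
    (simp add: adjoint_pairD [OF adjoint_pair_sym [OF assms], symmetric] cinner_add_right)

lemma adjoint_pair_funpow: "adjoint_pair A B \<Longrightarrow> adjoint_pair (A ^^ m) (B ^^ m)"
proof (induction m)
  case (Suc m)
  then show ?case
    unfolding adjoint_pair_def by (metis comp_apply funpow.simps(2) funpow_Suc_right)
qed (simp add: adjoint_pair_def)

lemma adjoint_pair_defect: "adjoint_pair A B \<Longrightarrow> adjoint_pair (defect m B A) (defect m B A)"
  using adjoint_pair_funpow [of A B m] adjoint_pair_funpow [OF adjoint_pair_sym, of A B m]
  by (simp add: adjoint_pair_def defect_def cinner_diff_left cinner_diff_right)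

lemma adjoint_pair_adj:
  fixes T :: "'a::chilbert_space \<Rightarrow> 'a"
  shows "operator_on UNIV T \<Longrightarrow> adjoint_pair T (adj T)"
  using adj_on(2) [OF closed_csubspace_UNIV] by (auto simp: adjoint_pair_def)

lemma funpow_mem: "x \<in> M \<Longrightarrow> T ` M \<subseteq> M \<Longrightarrow> (T ^^ m) x \<in> M"
  by (induction m) auto

lemma funpow_inverse:
  assumes "\<And>x. x \<in> M \<Longrightarrow> B (A x) = x" "A ` M \<subseteq> M" "x \<in> M"
  shows "(B ^^ m) ((A ^^ m) x) = x"
proof (induction m)
  case (Suc m)
  have "(B ^^ Suc m) ((A ^^ Suc m) x) = (B ^^ m) (B (A ((A ^^ m) x)))"
    by (simp add: funpow_swap1)
  then show ?case
    using Suc assms funpow_mem [OF assms(3,2)] by simp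
qed simp

section \<open>Reducing subspaces\<close>

text \<open>Invariance of the orthogonal complement under \<open>T\<close> amounts to invariance of \<open>M\<close> under the
  adjoint, because \<open>M\<close> is its own double orthogonal complement.\<close>

lemma reduces_iff:
  fixes T :: "'a::chilbert_space \<Rightarrow> 'a"
  assumes T: "operator_on UNIV T"
  shows "reduces M T \<longleftrightarrow> closed_csubspace M \<and> T ` M \<subseteq> M \<and> adj T ` M \<subseteq> M"
proof -
  note pair = adjoint_pairD [OF adjoint_pair_adj [OF T]]
    adjoint_pairD [OF adjoint_pair_sym [OF adjoint_pair_adj [OF T]]]
  have "adj T ` M \<subseteq> M" if M: "closed_csubspace M" and "T ` orthogonal_complement M \<subseteq> orthogonal_complement M"
  proof -
    have "adj T x \<in> orthogonal_complement (orthogonal_complement M)" if "x \<in> M" for x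
      unfolding orthogonal_complement_def [of "orthogonal_complement M"]
    proof (intro CollectI ballI)
      fix y assume "y \<in> orthogonal_complement M"
      then have "T y \<in> orthogonal_complement M"
        using \<open>T ` orthogonal_complement M \<subseteq> orthogonal_complement M\<close> by blast
      then show "cinner (adj T x) y = 0"
        using that by (simp add: pair orthogonal_complement_def cinner_eq_0_commute [of x])
    qed
    then show ?thesis
      using orthogonal_complement_orthogonal_complement [OF M] by auto
  qed
  moreover have "T ` orthogonal_complement M \<subseteq> orthogonal_complement M" if "adj T ` M \<subseteq> M"
    using that by (auto simp: orthogonal_complement_def pair)
  ultimately show ?thesis
    by (auto simp: reduces_on_def)
qed

lemma reduces_orthogonal_complement:
  fixes T :: "'a::chilbert_space \<Rightarrow> 'a"
  assumes "reduces M T"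
  shows "reduces (orthogonal_complement M) T"
  using assms by (simp add: reduces_on_def closed_csubspace_orthogonal_complement
      orthogonal_complement_orthogonal_complement)

lemma reduces_Int:
  fixes T :: "'a::chilbert_space \<Rightarrow> 'a"
  assumes "operator_on UNIV T" "reduces M T" "reduces N T"
  shows "reduces (M \<inter> N) T"
  using assms by (auto simp: reduces_iff closed_csubspace_Int)

lemma reduces_on_subset: "reduces N T \<Longrightarrow> N \<subseteq> M \<Longrightarrow> T ` M \<subseteq> M \<Longrightarrow> reduces_on M N T"
  by (auto simp: reduces_on_def)

lemma operator_on_subset: "operator_on UNIV T \<Longrightarrow> T ` M \<subseteq> M \<Longrightarrow> operator_on M T"
  unfolding operator_on_def by blast

text \<open>This turns statements about the restriction of \<open>T\<close> to a reducing subspace into statements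
  about \<open>T\<close> and its adjoint on the whole space.\<close>

lemma adj_on_reducing:
  fixes T :: "'a::chilbert_space \<Rightarrow> 'a"
  assumes T: "operator_on UNIV T" and M: "reduces M T" and "x \<in> M"
  shows "adj_on M T x = adj T x"
  using assms by (intro adj_on_eqI) (auto simp: reduces_iff adjoint_pairD [OF adjoint_pair_adj [OF T]])

lemma unitary_on_reducing_iff:
  fixes T :: "'a::chilbert_space \<Rightarrow> 'a"
  assumes T: "operator_on UNIV T" and M: "reduces M T"
  shows "unitary_on M T \<longleftrightarrow> (\<forall>x\<in>M. adj T (T x) = x \<and> T (adj T x) = x)"
proof -
  have "operator_on M T"
    using T M by (auto simp: reduces_on_def intro: operator_on_subset)
  moreover have "T x \<in> M" if "x \<in> M" for x
    using M that by (auto simp: reduces_on_def)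
  ultimately show ?thesis
    by (simp add: unitary_on_def adj_on_reducing [OF T M])
qed

lemma unitary_on_isometric:
  fixes N :: "'a::chilbert_space set"
  assumes N: "closed_csubspace N" and T: "unitary_on N T" and x: "x \<in> N"
  shows "norm (T x) = norm x"
proof -
  have op: "operator_on N T"
    using T by (simp add: unitary_on_def)
  then have "T x \<in> N"
    using x by (auto simp: operator_on_def)
  then have "cinner (T x) (T x) = cinner x x"
    using adj_on(2) [OF N op x, of "T x"] T x by (simp add: unitary_on_def)
  then show ?thesis
    by (simp add: cinner_self del: of_real_power)
qed

lemma unitary_on_funpow_isometric:
  fixes N :: "'a::chilbert_space set"
  assumes N: "closed_csubspace N" and T: "unitary_on N T" and x: "x \<in> N"
  shows "norm ((T ^^ m) x) = norm x"
proof (induction m)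
  case (Suc m)
  have "T ` N \<subseteq> N"
    using T by (simp add: unitary_on_def operator_on_def)
  then show ?case
    using Suc unitary_on_isometric [OF N T funpow_mem [OF x]] by simp
qed simp

text \<open>The powers of \<open>T\<close> are isometric on \<open>N\<close> and tend to 0 there.\<close>

lemma C00_on_subspace_trivial:
  fixes N :: "'a::chilbert_space set"
  assumes "C00_on K T" "closed_csubspace N" "unitary_on N T" "N \<subseteq> K"
  shows "N = {0}"
proof -
  have "x = 0" if "x \<in> N" for x
  proof -
    have "(\<lambda>m. norm ((T ^^ m) x)) \<longlonglongrightarrow> 0"
      using assms that by (auto simp: C00_on_def)
    then have "(\<lambda>m::nat. norm x) \<longlonglongrightarrow> 0"
      by (simp add: unitary_on_funpow_isometric [OF assms(2,3) that])
    then show ?thesis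
      by (simp add: LIMSEQ_const_iff)
  qed
  then show ?thesis
    using closed_csubspaceD(1) [OF assms(2)] by blast
qed

section \<open>Canonical decompositions with a completely non-unitary part in C00\<close>

locale C00_canonical =
  fixes T :: "'a::chilbert_space \<Rightarrow> 'a" and Hu Hn :: "'a set"
  assumes contraction: "contraction_on UNIV T"
    and canonical: "canonical_decomposition T Hu Hn"
    and C00: "C00_on Hn T"
begin

lemma operator: "operator_on UNIV T"
  using contraction by (simp add: contraction_on_def)

lemmas pair = adjoint_pair_adj [OF operator]

lemma reduces_parts: "reduces Hu T" "reduces Hn T"
  using canonical by (simp_all add: canonical_decomposition_def)

lemma closed_parts: "closed_csubspace Hu" "closed_csubspace Hn"
  using reduces_parts by (simp_all add: reduces_on_def)

lemma unitary_Hu: "unitary_on Hu T"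
  using canonical by (simp add: canonical_decomposition_def)

lemma parts_orthogonal: "u \<in> Hu \<Longrightarrow> n \<in> Hn \<Longrightarrow> cinner u n = 0"
  using canonical by (simp add: canonical_decomposition_def orthogonal_decomposition_def)

lemma parts_sum:
  obtains u n where "u \<in> Hu" "n \<in> Hn" "h = u + n"
proof -
  obtain hs where "list_all2 (\<in>) hs [Hu, Hn]" "h = sum_list hs"
    using canonical unfolding canonical_decomposition_def orthogonal_decomposition_def by blast
  then show thesis
    by (auto simp: list_all2_Cons2 intro: that)
qed

lemma Hn_eq: "Hn = orthogonal_complement Hu"
proof
  show "Hn \<subseteq> orthogonal_complement Hu"
    using parts_orthogonal cinner_eq_0_commute by (fastforce simp: orthogonal_complement_def)
  show "orthogonal_complement Hu \<subseteq> Hn"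
  proof
    fix x assume x: "x \<in> orthogonal_complement Hu"
    obtain u n where un: "u \<in> Hu" "n \<in> Hn" "x = u + n"
      by (rule parts_sum)
    then have "cinner x u = 0" "cinner n u = 0"
      using x parts_orthogonal [of u n] cinner_eq_0_commute [of n u]
      by (simp_all add: orthogonal_complement_def)
    then show "x \<in> Hn"
      using un by (simp add: cinner_add_left)
  qed
qed

lemma Hu_eq: "Hu = orthogonal_complement Hn"
  unfolding Hn_eq by (simp add: orthogonal_complement_orthogonal_complement closed_parts)

lemma adj_tendsto_0: "n \<in> Hn \<Longrightarrow> (\<lambda>m. norm ((adj T ^^ m) n)) \<longlonglongrightarrow> 0"
proof -
  assume n: "n \<in> Hn"
  have inv: "adj T ` Hn \<subseteq> Hn"
    using reduces_parts(2) by (simp add: reduces_iff [OF operator])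
  have "(adj_on Hn T ^^ m) n = (adj T ^^ m) n" for m
    by (induction m) (simp_all add: adj_on_reducing [OF operator reduces_parts(2)] funpow_mem [OF n inv])
  moreover have "(\<lambda>m. norm ((adj_on Hn T ^^ m) n)) \<longlonglongrightarrow> 0"
    using C00 n unfolding C00_on_def by blast
  ultimately show ?thesis
    by simp
qed

lemma tendsto_0: "n \<in> Hn \<Longrightarrow> (\<lambda>m. norm ((T ^^ m) n)) \<longlonglongrightarrow> 0"
  using C00 by (simp add: C00_on_def)

text \<open>If all defects of \<open>x\<close> vanish, then so do those of its component in \<open>Hn\<close>; the powers of \<open>T\<close>
  preserve the norm of that component and send it to 0, so it is 0.\<close>

lemma mem_Hu_iff: "x \<in> Hu \<longleftrightarrow> (\<forall>m. defect m (adj T) T x = 0 \<and> defect m T (adj T) x = 0)"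
proof -
  have zero: "defect m (adj T) T x = 0" "defect m T (adj T) x = 0" if "x \<in> Hu" for x m
  proof -
    have "\<forall>x\<in>Hu. adj T (T x) = x \<and> T (adj T x) = x" and inv: "T ` Hu \<subseteq> Hu" "adj T ` Hu \<subseteq> Hu"
      using unitary_Hu reduces_parts(1) unitary_on_reducing_iff [OF operator reduces_parts(1)]
      by (simp_all add: reduces_iff [OF operator])
    then show "defect m (adj T) T x = 0" "defect m T (adj T) x = 0"
      using that funpow_inverse [of Hu "adj T" T x m] funpow_inverse [of Hu T "adj T" x m]
      by (simp_all add: defect_def)
  qed
  show ?thesis
  proof
    assume D: "\<forall>m. defect m (adj T) T x = 0 \<and> defect m T (adj T) x = 0"
    obtain u n where un: "u \<in> Hu" "n \<in> Hn" "x = u + n"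
      by (rule parts_sum)
    have "defect m (adj T) T n = 0" for m
      using D zero [OF un(1)] adjoint_pair_diff [OF adjoint_pair_defect [OF pair], of m x u] un(3) by simp
    then have "cinner ((T ^^ m) n) ((T ^^ m) n) = cinner n n" for m
      by (simp add: adjoint_pairD [OF adjoint_pair_funpow [OF pair]] defect_def)
    then have "norm ((T ^^ m) n) = norm n" for m
      by (simp add: cinner_self del: of_real_power)
    then have "n = 0"
      using tendsto_0 [OF un(2)] by (simp add: LIMSEQ_const_iff)
    with un show "x \<in> Hu"
      by simp
  qed (simp add: zero)
qed

lemma ker_Int_eq:
  "(\<Inter>m. ker_on K (defect m (adj T) T) \<inter> ker_on K (defect m T (adj T))) = K \<inter> Hu"
  by (auto simp: ker_on_def mem_Hu_iff)

lemma reducing_defect: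
  assumes "reduces K T" "x \<in> K"
  shows "defect m (adj T) T x \<in> K" "defect m T (adj T) x \<in> K"
  using assms closed_csubspaceD(3) [of K]
  by (auto simp: reduces_iff [OF operator] defect_def intro!: funpow_mem)

text \<open>Defects commute with the projection onto \<open>K\<close>, so that projection preserves their common
  kernel \<open>Hu\<close>.\<close>

lemma reducing_component_mem_Hu:
  assumes K: "reduces K T" and u: "p + q \<in> Hu" and pq: "p \<in> K" "q \<in> orthogonal_complement K"
  shows "p \<in> Hu"
proof -
  have zero: "D p = 0"
    if D: "adjoint_pair D D" and "D (p + q) = 0" "D p \<in> K" "D q \<in> orthogonal_complement K" for D
  proof -
    have "D p = - D q"
      using that by (simp add: adjoint_pair_add eq_neg_iff_add_eq_0)
    moreover have "cinner (D q) (D p) = 0"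
      using that by (simp add: orthogonal_complement_def)
    ultimately show ?thesis
      by (metis cinner_self_eq_0 diff_0 cinner_diff_left cinner_zero_left diff_zero)
  qed
  show ?thesis
    using u reducing_defect [OF K pq(1)] reducing_defect [OF reduces_orthogonal_complement [OF K] pq(2)]
    unfolding mem_Hu_iff
    by (blast intro: zero adjoint_pair_defect pair adjoint_pair_sym)
qed

text \<open>Any \<open>u\<close> in \<open>Hu\<close> pairs with \<open>r\<close> only through its component in \<open>K\<close>, which again lies in \<open>Hu\<close>.\<close>

lemma reducing_orthogonal_to_Int_Hu:
  assumes K: "reduces K T" and "r \<in> K" and r: "\<And>u. u \<in> K \<inter> Hu \<Longrightarrow> cinner r u = 0"
  shows "r \<in> Hn"
proof -
  have "cinner r u = 0" if "u \<in> Hu" for u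
  proof -
    obtain p q where pq: "p \<in> K" "q \<in> orthogonal_complement K" "u = p + q"
      using K orthogonal_projection by (metis reduces_on_def)
    then have "p \<in> Hu"
      using reducing_component_mem_Hu [OF K] that by blast
    then show ?thesis
      using pq r \<open>r \<in> K\<close> by (auto simp: cinner_add_right orthogonal_complement_def cinner_eq_0_commute)
  qed
  then show ?thesis
    by (simp add: Hn_eq orthogonal_complement_def)
qed

lemma reducing_splits:
  assumes K: "reduces K T" and x: "x \<in> K"
  obtains a b where "a \<in> K \<inter> Hu" "b \<in> K \<inter> Hn" "x = a + b"
proof -
  have cl: "closed_csubspace K"
    using K by (simp add: reduces_on_def)
  obtain a b where ab: "a \<in> K \<inter> Hu" "b \<in> orthogonal_complement (K \<inter> Hu)" "x = a + b"
    using orthogonal_projection [OF closed_csubspace_Int [OF cl closed_parts(1)]] .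
  then have "b \<in> K"
    using closed_csubspaceD(3) [OF cl x, of a] by simp
  moreover from this have "b \<in> Hn"
    using ab by (intro reducing_orthogonal_to_Int_Hu [OF K]) (auto simp: orthogonal_complement_def)
  ultimately show thesis
    using ab that by blast
qed

text \<open>The next two lemmas turn the types of a pair of operators on a piece of a decomposition into
  inclusions of that piece, which makes existence and uniqueness of the decomposition set-theoretic.\<close>

lemma unitary_on_iff_subset:
  assumes K: "reduces K T"
  shows "unitary_on K T \<longleftrightarrow> K \<subseteq> Hu"
proof
  assume "unitary_on K T"
  then have inverse: "adj T (T x) = x" "T (adj T x) = x" if "x \<in> K" for x
    using that unitary_on_reducing_iff [OF operator K] by blast+
  have invariant: "T ` K \<subseteq> K" "adj T ` K \<subseteq> K"
    using K by (simp_all add: reduces_iff [OF operator])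
  show "K \<subseteq> Hu"
  proof
    fix x assume x: "x \<in> K"
    have "(adj T ^^ m) ((T ^^ m) x) = x" "(T ^^ m) ((adj T ^^ m) x) = x" for m
      using funpow_inverse [OF inverse(1) invariant(1) x] funpow_inverse [OF inverse(2) invariant(2) x]
      by simp_all
    then show "x \<in> Hu"
      by (simp add: mem_Hu_iff defect_def)
  qed
next
  assume "K \<subseteq> Hu"
  then show "unitary_on K T"
    using unitary_Hu unitary_on_reducing_iff [OF operator] K reduces_parts(1) by blast
qed

lemma cnu_on_iff_subset:
  assumes K: "reduces K T"
  shows "cnu_on K T \<longleftrightarrow> K \<subseteq> Hn"
proof
  have inv: "T ` K \<subseteq> K"
    using K by (simp add: reduces_on_def)
  {
    assume cnu: "cnu_on K T"
    have red: "reduces (K \<inter> Hu) T"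
      by (rule reduces_Int [OF operator K reduces_parts(1)])
    then have "K \<inter> Hu = {0}"
      using cnu reduces_on_subset [OF red _ inv] unitary_on_iff_subset [OF red]
      by (simp add: cnu_on_def)
    then show "K \<subseteq> Hn"
      using reducing_orthogonal_to_Int_Hu [OF K] by auto
  }
  assume "K \<subseteq> Hn"
  then have "N = {0}" if "reduces_on K N T" "unitary_on N T" for N
    using that by (intro C00_on_subspace_trivial [OF C00]) (auto simp: reduces_on_def)
  then show "cnu_on K T"
    using contraction operator_on_subset [OF operator inv]
    by (simp add: cnu_on_def contraction_on_def)
qed

text \<open>The defects are self-adjoint and map \<open>K\<close> to itself, so a vector of \<open>K\<close> is orthogonal to all defect ranges exactly
  when all its defects vanish, that is, when it lies in \<open>Hu\<close>.\<close>

lemma defect_span_eq: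
  assumes K: "reduces K T"
  shows "closed_cspan (\<Union>m. defect m (adj T) T ` K \<union> defect m T (adj T) ` K) = K \<inter> Hn"
    (is "closed_cspan ?S = _")
proof
  have cl: "closed_csubspace K"
    using K by (simp add: reduces_on_def)
  have selfadjoint: "cinner (defect m (adj T) T x) y = cinner x (defect m (adj T) T y)"
    "cinner (defect m T (adj T) x) y = cinner x (defect m T (adj T) y)" for m x y
    by (rule adjoint_pairD adjoint_pair_defect pair adjoint_pair_sym)+
  have "?S \<subseteq> Hn"
    by (auto simp: Hn_eq orthogonal_complement_def selfadjoint mem_Hu_iff [THEN iffD1, rule_format])
  moreover have "?S \<subseteq> K"
    using reducing_defect [OF K] by blast
  ultimately show sub: "closed_cspan ?S \<subseteq> K \<inter> Hn"
    by (intro closed_cspan_minimal closed_csubspace_Int cl closed_parts) blast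
  show "K \<inter> Hn \<subseteq> closed_cspan ?S"
  proof
    fix x assume x: "x \<in> K \<inter> Hn"
    obtain s r where sr: "s \<in> closed_cspan ?S" "r \<in> orthogonal_complement (closed_cspan ?S)" "x = s + r"
      using orthogonal_projection [OF closed_csubspace_closed_cspan] .
    then have r: "r \<in> K" "r \<in> Hn"
      using x sub closed_csubspaceD(3) [OF cl, of x s] closed_csubspaceD(3) [OF closed_parts(2), of x s]
      by auto
    have orth: "cinner r y = 0" if "y \<in> ?S" for y
      using sr(2) subsetD [OF closed_cspan_superset that] by (simp add: orthogonal_complement_def)
    have "defect m (adj T) T r = 0" "defect m T (adj T) r = 0" for m
    proof -
      have "cinner r (defect m (adj T) T (defect m (adj T) T r)) = 0"
        "cinner r (defect m T (adj T) (defect m T (adj T) r)) = 0"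
        using reducing_defect [OF K r(1), of m] by (intro orth; blast)+
      then have "cinner (defect m (adj T) T r) (defect m (adj T) T r) = 0"
        "cinner (defect m T (adj T) r) (defect m T (adj T) r) = 0"
        by (simp_all only: selfadjoint)
      then show "defect m (adj T) T r = 0" "defect m T (adj T) r = 0"
        by simp_all
    qed
    then have "r \<in> Hu"
      by (simp add: mem_Hu_iff)
    with r have "r = 0"
      using parts_orthogonal [of r r] by simp
    with sr show "x \<in> closed_cspan ?S"
      by simp
  qed
qed

end

section \<open>Twisted pairs\<close>

text \<open>The twist of the swapped pair is the adjoint, that is the inverse, of the original twist.\<close>

lemma twisted_sym:
  fixes T1 T2 :: "'a::chilbert_space \<Rightarrow> 'a"
  assumes "twisted T1 T2"
  shows "twisted T2 T1"
proof -
  obtain U where U: "unitary_on UNIV U" and tw: "T1 \<circ> T2 = U \<circ> T2 \<circ> T1"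
    and com: "T1 \<circ> U = U \<circ> T1" "T2 \<circ> U = U \<circ> T2"
    using assms by (auto simp: twisted_def)
  have op: "operator_on UNIV U" and inv: "adj U (U x) = x" "U (adj U x) = x" for x
    using U by (auto simp: unitary_on_def)
  have pair: "adjoint_pair (adj U) U"
    by (rule adjoint_pair_sym [OF adjoint_pair_adj [OF op]])
  have isom: "norm (adj U x) = norm x" for x
    using unitary_on_isometric [OF closed_csubspace_UNIV U, of "adj U x"] by (simp add: inv)
  have "operator_on UNIV (adj U)"
    unfolding operator_on_def
    by (auto simp: adjoint_pair_add [OF pair] adjoint_pair_scaleC [OF pair] isom intro!: exI [of _ 1])
  moreover have "adj (adj U) = U"
    using adj_on_eqI [OF closed_csubspace_UNIV, of U "adj U"] pair by (auto simp: adjoint_pair_def)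
  ultimately have "unitary_on UNIV (adj U)"
    by (simp add: unitary_on_def inv)
  moreover have "T2 \<circ> T1 = adj U \<circ> T1 \<circ> T2"
    using tw inv by (simp add: fun_eq_iff)
  moreover have "T \<circ> adj U = adj U \<circ> T" if "T \<circ> U = U \<circ> T" for T
    using that inv by (simp add: fun_eq_iff) metis
  ultimately show ?thesis
    using com unfolding twisted_def by blast
qed

lemma twisted_funpow:
  assumes tw: "\<And>x. T1 (T2 x) = U (T2 (T1 x))" and com: "\<And>x. T1 (U x) = U (T1 x)"
  shows "(T1 ^^ m) (T2 x) = (U ^^ m) (T2 ((T1 ^^ m) x))"
proof (induction m arbitrary: x)
  case (Suc m)
  have T1U: "T1 ((U ^^ k) x) = (U ^^ k) (T1 x)" for k x
    by (induction k) (simp_all add: com)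
  show ?case
    by (simp add: Suc T1U tw funpow_swap1)
qed simp

text \<open>It suffices that \<open>S\<close> maps neither part into the other. Let \<open>x \<in> Hu\<close> and \<open>y \<in> Hn\<close>, and write
  \<open>T*\<close> for the adjoint of \<open>T\<close>. As \<open>T\<close> is unitary on \<open>Hu\<close>, \<open>x = T ^ m z\<close> for some \<open>z\<close> of the same
  norm, and moving the power across the twist gives
  \<open>cinner (S x) y = cinner (S z) (U ^ m (T* ^ m y))\<close>, which tends to 0 because \<open>T* ^ m y\<close> does.
  Likewise \<open>x = T* ^ m z\<close> with \<open>z = T ^ m x\<close>, and \<open>cinner (S y) x = cinner (U ^ m (S (T ^ m y))) z\<close>
  tends to 0 because \<open>T ^ m y\<close> does. Both computations exchange powers of \<open>T\<close>, and not of \<open>T*\<close>, with \<open>S\<close>,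
  as the twist relation requires.\<close>

lemma (in C00_canonical) twisted_reduces:
  assumes S: "contraction_on UNIV S" and tw: "twisted T S"
  shows "reduces Hu S" "reduces Hn S"
proof -
  obtain U where U: "unitary_on UNIV U" and twU: "\<And>x. T (S x) = U (S (T x))"
    and com: "\<And>x. T (U x) = U (T x)"
    using tw by (auto simp: twisted_def fun_eq_iff)
  have norm_S: "norm (S x) \<le> norm x" and opS: "operator_on UNIV S" for x
    using S by (auto simp: contraction_on_def)
  have opU: "operator_on UNIV U" and inv: "adj U (U x) = x" "U (adj U x) = x" for x
    using U by (auto simp: unitary_on_def)
  note pairU = adjoint_pair_adj [OF opU]
  have norm_U: "norm ((U ^^ m) x) = norm x" for m x
    by (rule unitary_on_funpow_isometric [OF closed_csubspace_UNIV U UNIV_I])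
  have cinner_U: "cinner ((U ^^ m) x) ((U ^^ m) y) = cinner x y" for m x y
    using funpow_inverse [of UNIV "adj U" U y m]
    by (simp add: adjoint_pairD [OF adjoint_pair_funpow [OF pairU]] inv)
  have com_adj: "adj T (U x) = U (adj T x)" for x
  proof (rule cinner_extensionality)
    fix z
    have "cinner z (adj T (U x)) = cinner (adj U (T z)) x"
      by (simp add: adjoint_pairD [OF pair, symmetric] adjoint_pairD [OF adjoint_pair_sym [OF pairU]])
    also have "adj U (T z) = T (adj U z)"
      using com [of "adj U z"] by (metis inv)
    finally show "cinner z (adj T (U x)) = cinner z (U (adj T x))"
      by (simp add: adjoint_pairD [OF pair] adjoint_pairD [OF adjoint_pair_sym [OF pairU], symmetric])
  qed
  have com_adj_pow: "(adj T ^^ m) ((U ^^ k) x) = (U ^^ k) ((adj T ^^ m) x)" for m k x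
  proof (induction m)
    case (Suc m)
    have "adj T ((U ^^ k) y) = (U ^^ k) (adj T y)" for y
      by (induction k) (simp_all add: com_adj)
    with Suc show ?case
      by simp
  qed simp
  have twisted_pow: "(T ^^ m) (S x) = (U ^^ m) (S ((T ^^ m) x))" for m x
    by (rule twisted_funpow) (rule twU com)+
  (* for x in Hu, powers of T and of its adjoint are mutually inverse and isometric *)
  have pow: "(T ^^ m) ((adj T ^^ m) x) = x" "(adj T ^^ m) ((T ^^ m) x) = x" if "x \<in> Hu" for m x
    using that by (simp_all add: mem_Hu_iff defect_def)
  have norm_pow: "norm ((adj T ^^ m) x) = norm x" "norm ((T ^^ m) x) = norm x" if "x \<in> Hu" for m x
  proof -
    have "cinner ((adj T ^^ m) x) ((adj T ^^ m) x) = cinner x x"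
      by (simp add: adjoint_pairD [OF adjoint_pair_funpow [OF adjoint_pair_sym [OF pair]]] pow that)
    moreover have "cinner ((T ^^ m) x) ((T ^^ m) x) = cinner x x"
      by (simp add: adjoint_pairD [OF adjoint_pair_funpow [OF pair]] pow that)
    ultimately show "norm ((adj T ^^ m) x) = norm x" "norm ((T ^^ m) x) = norm x"
      by (simp_all add: cinner_self del: of_real_power)
  qed
  have zero: "w = 0" if "\<And>m. cmod w \<le> c * r m" and r: "r \<longlonglongrightarrow> 0" for w :: complex and c r
  proof -
    have "(\<lambda>m. c * r m) \<longlonglongrightarrow> c * 0"
      using r by (intro tendsto_intros)
    then have "cmod w \<le> c * 0"
      using that by (intro LIMSEQ_le_const) auto
    then show ?thesis
      by simp
  qed
  have *: "cinner (S x) y = 0" if x: "x \<in> Hu" and y: "y \<in> Hn" for x y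
  proof (rule zero [OF _ adj_tendsto_0 [OF y]])
    fix m
    let ?z = "(adj T ^^ m) x"
    have "cinner (S x) y = cinner ((U ^^ m) (S ((T ^^ m) ?z))) ((U ^^ m) y)"
      by (simp add: pow x cinner_U)
    also have "\<dots> = cinner (S ?z) ((U ^^ m) ((adj T ^^ m) y))"
      by (simp add: twisted_pow [symmetric] com_adj_pow
          adjoint_pairD [OF adjoint_pair_funpow [OF pair]])
    also have "cmod \<dots> \<le> norm (S ?z) * norm ((adj T ^^ m) y)"
      using cinner_Cauchy_Schwarz norm_U by metis
    also have "\<dots> \<le> norm x * norm ((adj T ^^ m) y)"
      using norm_S [of ?z] by (intro mult_right_mono) (simp_all add: norm_pow x)
    finally show "cmod (cinner (S x) y) \<le> norm x * norm ((adj T ^^ m) y)" .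
  qed
  have **: "cinner (S y) x = 0" if x: "x \<in> Hu" and y: "y \<in> Hn" for x y
  proof (rule zero [OF _ tendsto_0 [OF y]])
    fix m
    let ?z = "(T ^^ m) x"
    have "cinner (S y) x = cinner ((T ^^ m) (S y)) ?z"
      by (simp add: adjoint_pairD [OF adjoint_pair_funpow [OF pair]] pow x)
    also have "\<dots> = cinner ((U ^^ m) (S ((T ^^ m) y))) ?z"
      by (simp add: twisted_pow)
    also have "cmod \<dots> \<le> norm ((U ^^ m) (S ((T ^^ m) y))) * norm ?z"
      by (rule cinner_Cauchy_Schwarz)
    also have "\<dots> = norm x * norm (S ((T ^^ m) y))"
      by (simp add: norm_U norm_pow x)
    also have "\<dots> \<le> norm x * norm ((T ^^ m) y)"
      using norm_S by (intro mult_left_mono) simp_all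
    finally show "cmod (cinner (S y) x) \<le> norm x * norm ((T ^^ m) y)" .
  qed
  show "reduces Hu S"
    unfolding reduces_on_def Hn_eq [symmetric] Int_UNIV_left
  proof (intro conjI closed_parts)
    show "S ` Hu \<subseteq> Hu"
      using * by (subst (2) Hu_eq) (auto simp: orthogonal_complement_def)
    show "S ` Hn \<subseteq> Hn"
      using ** by (subst (2) Hn_eq) (auto simp: orthogonal_complement_def)
  qed simp
  then show "reduces Hn S"
    unfolding Hn_eq by (rule reduces_orthogonal_complement)
qed

section \<open>The decomposition of a twisted pair\<close>

lemma cinner_sum_list_eq_0:
  assumes "list_all2 (\<in>) ys Ms" and "\<And>M y. M \<in> set Ms \<Longrightarrow> y \<in> M \<Longrightarrow> cinner x y = 0"
  shows "cinner x (sum_list ys) = 0"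
  using assms
proof (induction rule: list_all2_induct)
  case (Cons y ys M Ms)
  have "cinner x y = 0"
    using Cons.prems [of M y] Cons.hyps by simp
  moreover have "cinner x (sum_list ys) = 0"
    using Cons.prems by (intro Cons.IH) auto
  ultimately show ?case
    by (simp add: cinner_add_right)
qed simp

text \<open>By induction on the list: the difference of two candidates for the first component is orthogonal to the remaining
  components, hence to itself.\<close>

lemma orthogonal_components_unique:
  assumes "\<forall>M\<in>set Ms. closed_csubspace M"
    and "sorted_wrt (\<lambda>M N. \<forall>x\<in>M. \<forall>y\<in>N. cinner x y = 0) Ms"
    and "list_all2 (\<in>) xs Ms" "list_all2 (\<in>) ys Ms" "sum_list xs = sum_list ys"
  shows "xs = ys"
  using assms
proof (induction Ms arbitrary: xs ys)
  case (Cons M Ms)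
  from Cons.prems(3,4) obtain x xs' y ys' where xs: "xs = x # xs'" "x \<in> M" "list_all2 (\<in>) xs' Ms"
    and ys: "ys = y # ys'" "y \<in> M" "list_all2 (\<in>) ys' Ms"
    by (auto simp: list_all2_Cons2)
  have "x - y \<in> M"
    using Cons.prems(1) xs(2) ys(2) closed_csubspaceD(3) [of M] by simp
  then have orth: "cinner (x - y) z = 0" if "N \<in> set Ms" "z \<in> N" for N z
    using Cons.prems(2) that unfolding sorted_wrt.simps by blast
  have diff: "x - y = sum_list ys' - sum_list xs'"
    using Cons.prems(5) xs(1) ys(1) by (simp add: algebra_simps)
  have "cinner (x - y) (x - y) = cinner (x - y) (sum_list ys') - cinner (x - y) (sum_list xs')"
    by (subst (2) diff) (rule cinner_diff_right)
  also have "\<dots> = 0"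
    using cinner_sum_list_eq_0 [OF xs(3) orth] cinner_sum_list_eq_0 [OF ys(3) orth] by simp
  finally have "x = y"
    by simp
  moreover have "xs' = ys'"
    using Cons.prems Cons.IH [OF _ _ xs(3) ys(3)] xs(1) ys(1) \<open>x = y\<close> by simp
  ultimately show ?case
    using xs(1) ys(1) by simp
qed simp

lemma sum_list_single_update: "i < n \<Longrightarrow> sum_list ((replicate n 0)[i := x]) = x"
  for x :: "'a::monoid_add"
proof (induction n arbitrary: i)
  case (Suc n)
  have "sum_list (replicate n (0::'a)) = 0"
    by (induction n) simp_all
  with Suc show ?case
    by (auto split: nat.split)
qed simp

text \<open>A vector of \<open>Ns ! i\<close> has two expansions along \<open>Ns\<close>: the one with the vector itself at position
  \<open>i\<close> and 0 elsewhere, and the one obtained from \<open>Ms\<close>. They agree, so the vector is already in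
  \<open>Ms ! i\<close>.\<close>

lemma orthogonal_decomposition_eqI:
  assumes small: "orthogonal_decomposition Ms" and large: "orthogonal_decomposition Ns"
    and sub: "list_all2 (\<subseteq>) Ms Ns"
  shows "Ms = Ns"
proof (rule nth_equalityI)
  show len: "length Ms = length Ns"
    using sub by (rule list_all2_lengthD)
  fix i assume i: "i < length Ms"
  have "x \<in> Ms ! i" if x: "x \<in> Ns ! i" for x
  proof -
    obtain hs where hs: "list_all2 (\<in>) hs Ms" "x = sum_list hs"
      using small unfolding orthogonal_decomposition_def by blast
    let ?ys = "(replicate (length Ns) 0)[i := x]"
    have "hs = ?ys"
    proof (rule orthogonal_components_unique)
      show "\<forall>M\<in>set Ns. closed_csubspace M"
        "sorted_wrt (\<lambda>M N. \<forall>x\<in>M. \<forall>y\<in>N. cinner x y = 0) Ns"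
        using large by (simp_all add: orthogonal_decomposition_def)
      then have "0 \<in> Ns ! k" if "k < length Ns" for k
        using that by (simp add: closed_csubspaceD(1))
      then show "list_all2 (\<in>) ?ys Ns"
        using x i len by (simp add: list_all2_conv_all_nth nth_list_update)
      show "list_all2 (\<in>) hs Ns"
        using hs(1) sub unfolding list_all2_conv_all_nth by (metis subsetD)
      show "sum_list hs = sum_list ?ys"
        using i len hs(2) by (simp add: sum_list_single_update)
    qed
    then show ?thesis
      using hs(1) i len by (auto simp: list_all2_conv_all_nth)
  qed
  moreover have "Ms ! i \<subseteq> Ns ! i"
    using sub i by (simp add: list_all2_nthD)
  ultimately show "Ms ! i = Ns ! i"
    by blast
qed

text \<open>All four intersections are obtained by splitting the reducing subspaces \<open>Hu1\<close> and \<open>Hn1\<close> of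
  \<open>T2\<close> along the canonical decomposition of \<open>T2\<close>. Conversely, the pieces of any decomposition
  lie in the respective intersections, and an orthogonal decomposition cannot be properly contained,
  piece by piece, in another one.\<close>

lemma pair_decomposition_iff:
  fixes T1 T2 :: "'a::chilbert_space \<Rightarrow> 'a"
  assumes 1: "C00_canonical T1 Hu1 Hn1" and 2: "C00_canonical T2 Hu2 Hn2" and tw: "twisted T1 T2"
  shows "pair_decomposition T1 T2 Huu Hun Hnu Hnn \<longleftrightarrow>
    Huu = Hu1 \<inter> Hu2 \<and> Hun = Hu1 \<inter> Hn2 \<and> Hnu = Hn1 \<inter> Hu2 \<and> Hnn = Hn1 \<inter> Hn2"
proof -
  interpret T1: C00_canonical T1 Hu1 Hn1 by (rule 1)
  interpret T2: C00_canonical T2 Hu2 Hn2 by (rule 2)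
  note red2 = T1.twisted_reduces [OF T2.contraction tw]
  note red1 = T2.twisted_reduces [OF T1.contraction twisted_sym [OF tw]]
  have reduces: "reduces M T1 \<and> reduces M T2"
    if "M \<in> {Hu1 \<inter> Hu2, Hu1 \<inter> Hn2, Hn1 \<inter> Hu2, Hn1 \<inter> Hn2}" for M
    using that T1.reduces_parts T2.reduces_parts red1 red2
    by (auto intro: reduces_Int T1.operator T2.operator)
  have split: "\<exists>hs. list_all2 (\<in>) hs [Hu1 \<inter> Hu2, Hu1 \<inter> Hn2, Hn1 \<inter> Hu2, Hn1 \<inter> Hn2] \<and> h = sum_list hs" for h
  proof -
    obtain u n where un: "u \<in> Hu1" "n \<in> Hn1" "h = u + n"
      by (rule T1.parts_sum)
    obtain a b where ab: "a \<in> Hu1 \<inter> Hu2" "b \<in> Hu1 \<inter> Hn2" "u = a + b"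
      by (rule T2.reducing_splits [OF red2(1) un(1)])
    obtain c d where cd: "c \<in> Hn1 \<inter> Hu2" "d \<in> Hn1 \<inter> Hn2" "n = c + d"
      by (rule T2.reducing_splits [OF red2(2) un(2)])
    show ?thesis
      using un(3) ab cd by (intro exI [of _ "[a, b, c, d]"]) (simp add: add.assoc)
  qed
  have ortho: "orthogonal_decomposition [Hu1 \<inter> Hu2, Hu1 \<inter> Hn2, Hn1 \<inter> Hu2, Hn1 \<inter> Hn2]"
    unfolding orthogonal_decomposition_def
  proof (intro conjI allI split)
    show "\<forall>M\<in>set [Hu1 \<inter> Hu2, Hu1 \<inter> Hn2, Hn1 \<inter> Hu2, Hn1 \<inter> Hn2]. closed_csubspace M"
      by (simp add: closed_csubspace_Int T1.closed_parts T2.closed_parts)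
    show "sorted_wrt (\<lambda>M N. \<forall>x\<in>M. \<forall>y\<in>N. cinner x y = 0)
        [Hu1 \<inter> Hu2, Hu1 \<inter> Hn2, Hn1 \<inter> Hu2, Hn1 \<inter> Hn2]"
      by (simp add: T1.parts_orthogonal T2.parts_orthogonal)
  qed
  show ?thesis
  proof
    assume *: "pair_decomposition T1 T2 Huu Hun Hnu Hnn"
    then have red: "reduces M T1" "reduces M T2" if "M \<in> {Huu, Hun, Hnu, Hnn}" for M
      using that by (auto simp: pair_decomposition_def)
    have "list_all2 (\<subseteq>) [Huu, Hun, Hnu, Hnn] [Hu1 \<inter> Hu2, Hu1 \<inter> Hn2, Hn1 \<inter> Hu2, Hn1 \<inter> Hn2]"
      using * by (simp add: pair_decomposition_def red
          flip: T1.unitary_on_iff_subset T1.cnu_on_iff_subset T2.unitary_on_iff_subset T2.cnu_on_iff_subset)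
    with * ortho have "[Huu, Hun, Hnu, Hnn] = [Hu1 \<inter> Hu2, Hu1 \<inter> Hn2, Hn1 \<inter> Hu2, Hn1 \<inter> Hn2]"
      by (intro orthogonal_decomposition_eqI) (simp_all add: pair_decomposition_def)
    then show "Huu = Hu1 \<inter> Hu2 \<and> Hun = Hu1 \<inter> Hn2 \<and> Hnu = Hn1 \<inter> Hu2 \<and> Hnn = Hn1 \<inter> Hn2"
      by simp
  next
    assume "Huu = Hu1 \<inter> Hu2 \<and> Hun = Hu1 \<inter> Hn2 \<and> Hnu = Hn1 \<inter> Hu2 \<and> Hnn = Hn1 \<inter> Hn2"
    then show "pair_decomposition T1 T2 Huu Hun Hnu Hnn"
      using ortho reduces
      by (simp add: pair_decomposition_def T1.unitary_on_iff_subset T1.cnu_on_iff_subset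
          T2.unitary_on_iff_subset T2.cnu_on_iff_subset)
  qed
qed

theorem theorem3p17:
  fixes T1 T2 :: "'a::chilbert_space \<Rightarrow> 'a"
    and Hu1 Hn1 Hu2 Hn2 :: "'a set"
  assumes "separable_space (euclidean :: 'a topology)"
    and "contraction_on UNIV T1" and "contraction_on UNIV T2"
    and "twisted T1 T2"
    and "canonical_decomposition T1 Hu1 Hn1"
    and "canonical_decomposition T2 Hu2 Hn2"
    and "C00_on Hn1 T1" and "C00_on Hn2 T2"
  shows "(\<exists>!Hs. case Hs of (Huu, Hun, Hnu, Hnn) \<Rightarrow> pair_decomposition T1 T2 Huu Hun Hnu Hnn) \<and>
    (\<forall>Huu Hun Hnu Hnn. pair_decomposition T1 T2 Huu Hun Hnu Hnn \<longrightarrow>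
       Huu = (\<Inter>m. ker_on Hu1 (defect m (adj T2) T2) \<inter> ker_on Hu1 (defect m T2 (adj T2))) \<and>
       Hun = closed_cspan (\<Union>m. defect m (adj T2) T2 ` Hu1 \<union> defect m T2 (adj T2) ` Hu1) \<and>
       Hnu = (\<Inter>m. ker_on Hn1 (defect m (adj T2) T2) \<inter> ker_on Hn1 (defect m T2 (adj T2))) \<and>
       Hnn = closed_cspan (\<Union>m. defect m (adj T2) T2 ` Hn1 \<union> defect m T2 (adj T2) ` Hn1)) \<and>
    Hu1 = (\<Inter>m. ker_on UNIV (defect m (adj T1) T1) \<inter> ker_on UNIV (defect m T1 (adj T1))) \<and>
    Hn1 = closed_cspan (\<Union>m. defect m (adj T1) T1 ` UNIV \<union> defect m T1 (adj T1) ` UNIV)"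
proof -
  interpret T1: C00_canonical T1 Hu1 Hn1
    using assms by unfold_locales
  interpret T2: C00_canonical T2 Hu2 Hn2
    using assms by unfold_locales
  note decomp = pair_decomposition_iff [OF T1.C00_canonical_axioms T2.C00_canonical_axioms assms(4)]
  note red2 = T1.twisted_reduces [OF T2.contraction assms(4)]
  have "reduces UNIV T1"
    by (simp add: reduces_iff [OF T1.operator] closed_csubspace_UNIV)
  then show ?thesis
    unfolding T1.ker_Int_eq T2.ker_Int_eq decomp T1.defect_span_eq [OF \<open>reduces UNIV T1\<close>]
      T2.defect_span_eq [OF red2(1)] T2.defect_span_eq [OF red2(2)]
    by auto
qed

end
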